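(* Let $\mathscr{A}$ be a (finite-dimensional) formally real Jordan algebra and let $\langle\cdot,\cdot\rangle$ be an associative inner product on $\mathscr{A}$. Then the Jordan curvature of $(\mathscr{A},\langle\cdot,\cdot\rangle)$ is non-positive, i.e. $\mathcal{J}(X,Y)\le0$ for all linearly independent $X,Y\in\mathscr{A}$. Moreover, the Jordan curvature vanishes identically if and only if $\mathscr{A}$ is a direct sum of copies of the one-dimensional simple Jordan algebra ($\mathbb{R}e_1$ with $e_1e_1=e_1$).
   Context: A (real) Jordan algebra is a real vector space $\mathscr{A}$ with a bilinear product satisfying $XY=YX$ and $X(X^2Y)=X^2(XY)$. It is formally real if it has an identity element and $X^2+Y^2=0$ implies $X=Y=0$. An inner product is associative if $\langle XY,Z\rangle=\langle X,YZ\rangle$ for all $X,Y,Z$. The Jordan-Levi-Civita connection of a Jordan algebra with inner product is the unique bilinear map $(X,Y)\mapsto\nabla_XY$ with $\nabla_XY+\nabla_YX=XY$ and $\langle\nabla_XY,Z\rangle=\langle Y,\nabla_XZ\rangle$ for all $X,Y,Z$; explicitly $\langle\nabla_XY,Z\rangle=\frac12(\langle XY,Z\rangle-\langle YZ,X\rangle+\langle ZX,Y\rangle)$. The Jordan curvature tensor is $R(X,Y)Z=-\nabla_X\nabla_YZ-\nabla_Y\nabla_XZ+\nabla_{XY}Z$, and the Jordan curvature is $$\mathcal{J}(X,Y)=\frac{\langle R(X,Y)X,Y\rangle}{\langle X,X\rangle\langle Y,Y\rangle-\langle X,Y\rangle^2}$$ for linearly independent $X,Y\in\mathscr{A}$.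 *)

theory Defs
  imports "HOL-Analysis.Analysis"
begin

section \<open>Jordan algebras\<close>

text \<open>The product is an arbitrary bilinear operation on a real vector space, independent of any
  multiplication or inner product the type may carry. The zero algebra is not excluded.\<close>

locale jordan_algebra =
  fixes mul :: "'a::real_vector \<Rightarrow> 'a \<Rightarrow> 'a"
  assumes bilinear_mul: "bilinear mul"
    and mul_commute: "mul X Y = mul Y X"
    and jordan_identity: "mul X (mul (mul X X) Y) = mul (mul X X) (mul X Y)"

locale formally_real_jordan_algebra = jordan_algebra mul
  for mul :: "'a::real_vector \<Rightarrow> 'a \<Rightarrow> 'a" +
  assumes identity_exists: "\<exists>E. \<forall>X. mul E X = X"
    and formally_real: "mul X X + mul Y Y = 0 \<Longrightarrow> X = 0 \<and> Y = 0"

locale finite_dim_formally_real_jordan_algebra = formally_real_jordan_algebra mul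
  for mul :: "'a::real_vector \<Rightarrow> 'a \<Rightarrow> 'a" +
  assumes finite_dim: "\<exists>B :: 'a set. finite B \<and> span B = UNIV"

definition inner_product :: "('a::real_vector \<Rightarrow> 'a \<Rightarrow> real) \<Rightarrow> bool" where
  "inner_product ip \<longleftrightarrow> bilinear ip \<and> (\<forall>X Y. ip X Y = ip Y X) \<and> (\<forall>X. X \<noteq> 0 \<longrightarrow> ip X X > 0)"

definition associative_inner_product ::
  "('a::real_vector \<Rightarrow> 'a \<Rightarrow> 'a) \<Rightarrow> ('a \<Rightarrow> 'a \<Rightarrow> real) \<Rightarrow> bool" where
  "associative_inner_product mul ip \<longleftrightarrow>
     inner_product ip \<and> (\<forall>X Y Z. ip (mul X Y) Z = ip X (mul Y Z))"

section \<open>Jordan-Levi-Civita connection and Jordan curvature\<close>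

definition is_jordan_levi_civita ::
  "('a::real_vector \<Rightarrow> 'a \<Rightarrow> 'a) \<Rightarrow> ('a \<Rightarrow> 'a \<Rightarrow> real) \<Rightarrow> ('a \<Rightarrow> 'a \<Rightarrow> 'a) \<Rightarrow> bool" where
  "is_jordan_levi_civita mul ip N \<longleftrightarrow>
     bilinear N \<and>
     (\<forall>X Y. N X Y + N Y X = mul X Y) \<and>
     (\<forall>X Y Z. ip (N X Y) Z = ip Y (N X Z))"

text \<open>That the following description is meaningful on every finite-dimensional Jordan algebra with
  inner product is shown in \<open>jordan_levi_civita_ex1\<close> below.\<close>

definition jordan_levi_civita ::
  "('a::real_vector \<Rightarrow> 'a \<Rightarrow> 'a) \<Rightarrow> ('a \<Rightarrow> 'a \<Rightarrow> real) \<Rightarrow> 'a \<Rightarrow> 'a \<Rightarrow> 'a" where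
  "jordan_levi_civita mul ip = (THE N. is_jordan_levi_civita mul ip N)"

definition jordan_curvature_tensor ::
  "('a::real_vector \<Rightarrow> 'a \<Rightarrow> 'a) \<Rightarrow> ('a \<Rightarrow> 'a \<Rightarrow> real) \<Rightarrow> 'a \<Rightarrow> 'a \<Rightarrow> 'a \<Rightarrow> 'a" where
  "jordan_curvature_tensor mul ip X Y Z =
     (let N = jordan_levi_civita mul ip in - N X (N Y Z) - N Y (N X Z) + N (mul X Y) Z)"

definition jordan_curvature ::
  "('a::real_vector \<Rightarrow> 'a \<Rightarrow> 'a) \<Rightarrow> ('a \<Rightarrow> 'a \<Rightarrow> real) \<Rightarrow> 'a \<Rightarrow> 'a \<Rightarrow> real" where
  "jordan_curvature mul ip X Y =
     ip (jordan_curvature_tensor mul ip X Y X) Y / (ip X X * ip Y Y - (ip X Y)\<^sup>2)"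

text \<open>The inequality is needed because \<open>{X, X}\<close> collapses to a singleton.\<close>

definition lin_indep_pair :: "'a::real_vector \<Rightarrow> 'a \<Rightarrow> bool" where
  "lin_indep_pair X Y \<longleftrightarrow> X \<noteq> Y \<and> independent {X, Y}"

section \<open>Direct sums of Jordan algebras\<close>

definition jordan_ideal :: "('a::real_vector \<Rightarrow> 'a \<Rightarrow> 'a) \<Rightarrow> 'a set \<Rightarrow> bool" where
  "jordan_ideal mul I \<longleftrightarrow> subspace I \<and> (\<forall>X. \<forall>Y\<in>I. mul X Y \<in> I \<and> mul Y X \<in> I)"

text \<open>Internal direct sum: the algebra is the direct sum, as a vector space, of the ideals
  \<open>I 0, \<dots>, I (n - 1)\<close>. Products of elements of distinct summands then lie in the intersection of
  the two ideals, hence vanish. The empty sum is the zero algebra.\<close>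

definition is_direct_sum ::
  "('a::real_vector \<Rightarrow> 'a \<Rightarrow> 'a) \<Rightarrow> nat \<Rightarrow> (nat \<Rightarrow> 'a set) \<Rightarrow> bool" where
  "is_direct_sum mul n I \<longleftrightarrow>
     (\<forall>i<n. jordan_ideal mul (I i)) \<and>
     (\<forall>X. \<exists>!f. f \<in> (\<Pi>\<^sub>E i\<in>{..<n}. I i) \<and> X = (\<Sum>i<n. f i))"

definition one_dim_simple :: "('a::real_vector \<Rightarrow> 'a \<Rightarrow> 'a) \<Rightarrow> 'a set \<Rightarrow> bool" where
  "one_dim_simple mul S \<longleftrightarrow> (\<exists>e. e \<noteq> 0 \<and> mul e e = e \<and> S = span {e})"

definition direct_sum_of_one_dim_simple :: "('a::real_vector \<Rightarrow> 'a \<Rightarrow> 'a) \<Rightarrow> bool" where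
  "direct_sum_of_one_dim_simple mul \<longleftrightarrow>
     (\<exists>n I. is_direct_sum mul n I \<and> (\<forall>i<n. one_dim_simple mul (I i)))"

section \<open>Existence and uniqueness of the Jordan-Levi-Civita connection\<close>

lemma inner_product_ext:
  assumes "inner_product ip" and "\<And>Z. ip U Z = ip V Z"
  shows "U = V"
proof (rule ccontr)
  assume "U \<noteq> V"
  then have "ip (U - V) (U - V) > 0" using assms(1) by (simp add: inner_product_def)
  moreover have "ip (U - V) (U - V) = 0"
    using assms(1) by (simp add: inner_product_def bilinear_lsub assms(2))
  ultimately show False by simp
qed

lemma jordan_levi_civita_formula:
  assumes "inner_product ip" and N: "is_jordan_levi_civita mul ip N"
  shows "ip (N X Y) Z = (ip (mul X Y) Z - ip (mul Y Z) X + ip (mul Z X) Y) / 2"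
proof -
  have s: "ip A B = ip B A" for A B using assms by (simp add: inner_product_def)
  have b: "bilinear ip" using assms by (simp add: inner_product_def)
  have t: "mul A B = N A B + N B A" for A B
    using N by (simp add: is_jordan_levi_civita_def)
  have c: "ip (N A B) C = ip (N A C) B" for A B C
    using N s by (metis is_jordan_levi_civita_def)
  show ?thesis
    unfolding t bilinear_ladd[OF b] using c[of X Y Z] c[of Y X Z] c[of Z X Y] by simp
qed

lemma inner_product_riesz:
  fixes ip :: "'a::real_vector \<Rightarrow> 'a \<Rightarrow> real"
  assumes ip: "inner_product ip" and "finite B" and "linear f"
  shows "\<exists>v\<in>span B. \<forall>w\<in>span B. ip v w = f w"
  using assms(2,3)
proof (induction B arbitrary: f rule: finite_induct)
  case empty
  have "bilinear ip" using ip by (simp add: inner_product_def)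
  then show ?case using linear_0[OF empty] by (simp add: bilinear_rzero)
next
  case (insert a B)
  have b: "bilinear ip" and s: "\<And>A B. ip A B = ip B A"
    using ip by (auto simp: inner_product_def)
  obtain v where v: "v \<in> span B" "\<forall>w\<in>span B. ip v w = f w"
    using insert.IH[OF insert.prems] by blast
  have "linear (ip a)" using b by (simp add: bilinear_def)
  then obtain p where p: "p \<in> span B" "\<forall>w\<in>span B. ip p w = ip a w"
    using insert.IH by blast
  define d where "d = a - p"
  have orth: "ip d w = 0" if "w \<in> span B" for w
    using that p by (simp add: d_def bilinear_lsub[OF b])
  show ?case
  proof (cases "d = 0")
    case True
    then have "a \<in> span B" using p by (simp add: d_def)
    then show ?thesis using v by (auto simp: span_redundant)
  next
    case False
    then have d: "ip d d > 0" using ip by (simp add: inner_product_def)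
    define u where "u = v + (f d / ip d d) *\<^sub>R d"
    have sub: "span B \<subseteq> span (insert a B)" by (simp add: span_mono subset_insertI)
    have "d \<in> span (insert a B)"
      unfolding d_def using p sub by (intro span_diff) (auto intro: span_base)
    then have "u \<in> span (insert a B)"
      unfolding u_def using v sub by (intro span_add span_scale) auto
    moreover have "ip u w = f w" if w_in: "w \<in> span (insert a B)" for w
    proof -
      obtain k where k: "w - k *\<^sub>R a \<in> span B" using w_in unfolding span_breakdown_eq by blast
      define z where "z = w - k *\<^sub>R a + k *\<^sub>R p"
      have z: "z \<in> span B" unfolding z_def using k p by (intro span_add span_scale) auto
      have w: "w = z + k *\<^sub>R d" by (simp add: z_def d_def algebra_simps)
      have "ip v d = 0" using orth[OF v(1)] s by simp
      then have "ip u w = f z + k * f d"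
        using d v(2) z orth[OF z]
        by (simp add: u_def w bilinear_ladd[OF b] bilinear_radd[OF b] bilinear_lmul[OF b]
            bilinear_rmul[OF b])
      also have "\<dots> = f w" using insert.prems by (simp add: w linear_add linear_scale)
      finally show ?thesis .
    qed
    ultimately show ?thesis by blast
  qed
qed

theorem jordan_levi_civita_ex1:
  fixes mul :: "'a::real_vector \<Rightarrow> 'a \<Rightarrow> 'a"
  assumes "jordan_algebra mul" and ip: "inner_product ip"
    and fin: "finite (B :: 'a set)" "span B = UNIV"
  shows "\<exists>!N. is_jordan_levi_civita mul ip N"
proof -
  interpret jordan_algebra mul by fact
  have b: "bilinear ip" and s: "\<And>A B. ip A B = ip B A"
    using ip by (auto simp: inner_product_def)
  define g where "g X Y Z = (ip (mul X Y) Z - ip (mul Y Z) X + ip (mul Z X) Y) / 2" for X Y Z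
  note bil = bilinear_ladd[OF b] bilinear_radd[OF b] bilinear_lmul[OF b] bilinear_rmul[OF b]
    bilinear_ladd[OF bilinear_mul] bilinear_radd[OF bilinear_mul]
    bilinear_lmul[OF bilinear_mul] bilinear_rmul[OF bilinear_mul]
  have "linear (g X Y)" for X Y
    by (rule linearI) (simp_all add: g_def bil field_simps)
  then have "\<exists>v. \<forall>w. ip v w = g X Y w" for X Y
    using inner_product_riesz[OF ip fin(1)] fin(2) by (metis UNIV_I)
  then obtain N where N: "ip (N X Y) Z = g X Y Z" for X Y Z by metis
  have "bilinear N"
    unfolding bilinear_def
    by (intro conjI allI linearI; rule inner_product_ext[OF ip])
      (simp_all add: N bil g_def add_divide_distrib diff_divide_distrib right_diff_distrib
        distrib_left)
  moreover have "N X Y + N Y X = mul X Y" for X Y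
  proof (rule inner_product_ext[OF ip])
    show "ip (N X Y + N Y X) Z = ip (mul X Y) Z" for Z
      using mul_commute[of X Y] mul_commute[of Z Y] mul_commute[of Z X]
      by (simp add: bil N g_def flip: add_divide_distrib)
  qed
  moreover have "ip (N X Y) Z = ip Y (N X Z)" for X Y Z
    using mul_commute[of X Y] mul_commute[of Z Y] mul_commute[of Z X]
    by (simp add: s[of Y "N X Z"] N g_def)
  ultimately have "is_jordan_levi_civita mul ip N"
    by (simp add: is_jordan_levi_civita_def)
  moreover have "N' = N''" if "is_jordan_levi_civita mul ip N'" "is_jordan_levi_civita mul ip N''"
    for N' N''
    by (intro ext inner_product_ext[OF ip])
      (simp only: that[THEN jordan_levi_civita_formula[OF ip]])
  ultimately show ?thesis by blast
qed

end

theory Submission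
  imports Defs
begin

text \<open>
  Write \<open>L X\<close> for multiplication by \<open>X\<close>. Associativity of the inner product says that every \<open>L X\<close>
  is self-adjoint, so the connection is \<open>\<nabla>\<^sub>X = (1/2) L X\<close>, and the numerator of the curvature becomes
  \<open>(|X Y|\<^sup>2 - \<langle>X\<^sup>2, Y\<^sup>2\<rangle>) / 4\<close>. This is \<open>-1/4\<close> times the quadratic form in \<open>Y\<close> of
  the self-adjoint operator \<open>D = L (X\<^sup>2) - (L X)\<^sup>2\<close>, called \<open>square_defect X\<close> below.

  Non-positivity of the curvature is therefore positivity of \<open>D\<close> (\<open>square_defect_nonneg\<close>). Suppose
  that \<open>D\<close> has an eigenvalue \<open>c < 0\<close>. By the Jordan identity \<open>D\<close> commutes with \<open>L X\<close>, so some
  \<open>Y \<noteq> 0\<close> is an eigenvector of both. Replacing \<open>X\<close> by \<open>X - m E\<close> (\<open>E\<close> the identity) does not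
  change \<open>D\<close>; it allows the assumption \<open>X Y = 0\<close>, and then \<open>X\<^sup>2 Y = c Y\<close>. The linearized Jordan
  identity now gives \<open>X\<^sup>n\<^sup>+\<^sup>2 Y = X\<^sup>2 (X\<^sup>n Y) = c X\<^sup>n Y\<close>, so that every element of the form
  \<open>(X\<^sup>2 - c) w\<close>, with \<open>w\<close> in the span \<open>S\<close> of the powers of \<open>X\<close>, annihilates \<open>Y\<close>. But
  \<open>X\<^sup>2 - c\<close> acts on \<open>S\<close> as the positive definite operator \<open>(L X)\<^sup>2 - c\<close>, so \<open>E\<close> itself has this
  form and \<open>Y = E Y = 0\<close> (\<open>no_negative_square_eigenvalue\<close>).

  If the curvature vanishes then \<open>D\<close> is positive semidefinite with vanishing quadratic form, hence
  zero: \<open>X\<^sup>2 Y = X (X Y)\<close> for all \<open>X, Y\<close>. Polarizing in \<open>X\<close> and using commutativity makes the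
  product associative (\<open>square_defect_0_imp_associative\<close>). In an associative algebra the eigenspaces
  of the \<open>L X\<close> are ideals, so every nonzero ideal contains a nonzero idempotent that spans an ideal.
  These idempotents are orthogonal, and as the orthogonal complement of their span is an ideal without
  any of them, it is zero (\<open>span_ideal_idempotents\<close>). Conversely, a direct sum of copies of
  \<open>\<real>\<close> multiplies coordinatewise, so \<open>D = 0\<close>.
\<close>

section \<open>Self-adjoint operators on a finite-dimensional inner product space\<close>

locale finite_dim_inner_product =
  fixes ip :: "'a::real_vector \<Rightarrow> 'a \<Rightarrow> real"
  assumes inner_product_ip: "inner_product ip"
    and finite_span: "\<exists>B :: 'a set. finite B \<and> span B = UNIV"
begin

lemma bilinear_ip: "bilinear ip"
  and ip_commute: "ip X Y = ip Y X"
  and ip_pos: "X \<noteq> 0 \<Longrightarrow> ip X X > 0"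
  using inner_product_ip by (auto simp: inner_product_def)

lemmas ip_simps = bilinear_ladd[OF bilinear_ip] bilinear_radd[OF bilinear_ip]
  bilinear_lsub[OF bilinear_ip] bilinear_rsub[OF bilinear_ip]
  bilinear_lmul[OF bilinear_ip] bilinear_rmul[OF bilinear_ip]
  bilinear_lzero[OF bilinear_ip] bilinear_rzero[OF bilinear_ip]
  bilinear_lneg[OF bilinear_ip] bilinear_rneg[OF bilinear_ip]

lemma linear_ip: "linear (ip X)" "linear (\<lambda>X. ip X Y)"
  using bilinear_ip by (auto simp: bilinear_def)

lemma ip_nonneg: "ip X X \<ge> 0"
  using ip_pos[of X] by (cases "X = 0") (auto simp: ip_simps)

lemma ip_eq_0_iff: "ip X X = 0 \<longleftrightarrow> X = 0"
  using ip_pos[of X] by (cases "X = 0") (auto simp: ip_simps)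

lemma finite_basis_of_subspace:
  assumes "subspace S"
  obtains G :: "'a set" where "finite G" "independent G" "span G = S" "G \<subseteq> S"
proof -
  obtain G where G: "G \<subseteq> S" "independent G" "S \<subseteq> span G"
    using real_vector.maximal_independent_subset[of S] by blast
  obtain B :: "'a set" where "finite B" "span B = UNIV" using finite_span by blast
  then have "finite G" using real_vector.independent_span_bound[of B G] G by simp
  moreover have "span G = S" using G assms by (metis span_minimal subset_antisym)
  ultimately show ?thesis using G that by blast
qed

text \<open>The projection of \<open>X\<close> is the Riesz representative on \<open>S\<close> of the functional \<open>ip X\<close>.\<close>

lemma orthogonal_projection_exists:
  assumes "subspace S"
  obtains u where "u \<in> S" "\<And>w. w \<in> S \<Longrightarrow> ip (X - u) w = 0"
proof -
  obtain G :: "'a set" where G: "finite G" "span G = S"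
    using finite_basis_of_subspace[OF assms] by blast
  obtain u where "u \<in> S" "\<forall>w\<in>S. ip u w = ip X w"
    using inner_product_riesz[OF inner_product_ip G(1) linear_ip(1)[of X]] unfolding G(2) by blast
  then show ?thesis using that by (simp add: ip_simps)
qed

text \<open>Evaluate at the minimum \<open>t = - b / c\<close> of the parabola; it degenerates to a line when \<open>c = 0\<close>.\<close>

lemma quadratic_nonneg_discriminant:
  fixes a b c :: real
  assumes "\<And>t. a + 2 * t * b + t\<^sup>2 * c \<ge> 0" and "c \<ge> 0"
  shows "b\<^sup>2 \<le> a * c"
proof (cases "c = 0")
  case True
  have "b = 0"
  proof (rule ccontr)
    assume "b \<noteq> 0"
    then show False using assms(1)[of "- (a + 1) / (2 * b)"] True by (simp add: field_simps)
  qed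
  then show ?thesis using True by simp
next
  case False
  then show ?thesis using assms(1)[of "- b / c"] assms(2)
    by (simp add: field_simps power2_eq_square)
qed

lemma semidefinite_Cauchy_Schwarz:
  assumes S: "subspace S" and T: "linear T"
    and sym: "\<And>v w. v \<in> S \<Longrightarrow> w \<in> S \<Longrightarrow> ip (T v) w = ip v (T w)"
    and pos: "\<And>v. v \<in> S \<Longrightarrow> ip (T v) v \<ge> 0"
    and u: "u \<in> S" and v: "v \<in> S"
  shows "(ip (T u) v)\<^sup>2 \<le> ip (T u) u * ip (T v) v"
proof (rule quadratic_nonneg_discriminant)
  fix t :: real
  have "u + t *\<^sub>R v \<in> S" using S u v by (simp add: subspace_add subspace_scale)
  then have "0 \<le> ip (T (u + t *\<^sub>R v)) (u + t *\<^sub>R v)" by (rule pos)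
  also have "\<dots> = ip (T u) u + 2 * t * ip (T u) v + t\<^sup>2 * ip (T v) v"
    using sym[OF u v] ip_commute[of u "T v"]
    by (simp add: ip_simps linear_add[OF T] linear_scale[OF T] algebra_simps power2_eq_square)
  finally show "0 \<le> ip (T u) u + 2 * t * ip (T u) v + t\<^sup>2 * ip (T v) v" .
qed (use pos v in blast)

lemma Cauchy_Schwarz: "(ip u v)\<^sup>2 \<le> ip u u * ip v v"
  using semidefinite_Cauchy_Schwarz[of UNIV "\<lambda>x. x" u v] ip_nonneg
  by (simp add: linear_iff)

text \<open>Stands in for compactness of the unit sphere. Expand \<open>v\<close> in a basis \<open>G\<close> of \<open>S\<close>. Each
  coordinate of \<open>v\<close> is \<open>ip (r b) v\<close> for some \<open>r b\<close> in \<open>S\<close>, so \<open>ip (T v) v\<close> is a sum of products of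
  two functionals \<open>ip u v\<close>, each of which has its square bounded by \<open>Q\<close>. The lemma is used for
  \<open>Q v = |v|\<^sup>2\<close>, where the bound is the Cauchy-Schwarz inequality, and for the form of a positive
  semidefinite surjective operator.\<close>

lemma quadratic_form_bounded:
  assumes S: "subspace S" and T: "linear T" "\<And>v. v \<in> S \<Longrightarrow> T v \<in> S"
    and Q: "\<And>u. u \<in> S \<Longrightarrow> \<exists>\<alpha>. \<forall>v\<in>S. (ip u v)\<^sup>2 \<le> \<alpha> * Q v"
  shows "\<exists>K. \<forall>v\<in>S. ip (T v) v \<le> K * Q v"
proof -
  obtain G where G: "finite G" "independent G" "span G = S" "G \<subseteq> S"
    using finite_basis_of_subspace[OF S] by blast
  have "\<exists>\<alpha>. \<forall>u\<in>S. \<forall>v\<in>S. (ip u v)\<^sup>2 \<le> \<alpha> u * Q v"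
    by (rule bchoice) (use Q in blast)
  then obtain \<alpha> where \<alpha>: "\<forall>u\<in>S. \<forall>v\<in>S. (ip u v)\<^sup>2 \<le> \<alpha> u * Q v" ..
  have "\<exists>r. r \<in> S \<and> (\<forall>v\<in>S. representation G v b = ip r v)" for b
  proof -
    have "\<exists>g. linear g \<and> (\<forall>x\<in>G. g x = (if x = b then 1 else 0 :: real))"
      by (rule linear_independent_extend[OF G(2)])
    then obtain g where g: "linear g" "\<forall>x\<in>G. g x = (if x = b then 1 else 0 :: real)"
      by (elim exE conjE)
    have "g v = representation G v b" if "v \<in> S" for v
    proof -
      have "g v = g (\<Sum>x\<in>G. representation G v x *\<^sub>R x)"
        using real_vector.sum_representation_eq[OF G(2) _ G(1) order_refl] that G(3) by simp
      also have "\<dots> = (\<Sum>x\<in>G. representation G v x * (if x = b then 1 else 0))"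
        using g by (simp add: linear_sum[OF g(1)] linear_scale[OF g(1)])
      also have "\<dots> = representation G v b"
        using G(1) real_vector.representation_ne_zero[of G v b] by (auto simp: if_distrib cong: if_cong)
      finally show ?thesis .
    qed
    then show ?thesis
      using inner_product_riesz[OF inner_product_ip G(1) g(1)] unfolding G(3) by auto
  qed
  then obtain r where r: "r b \<in> S" "\<And>v. v \<in> S \<Longrightarrow> representation G v b = ip (r b) v" for b
    by metis
  have "ip (T v) v \<le> (\<Sum>b\<in>G. (\<alpha> (r b) + \<alpha> (T b)) / 2) * Q v" if v: "v \<in> S" for v
  proof -
    have "ip (T v) v = ip (T (\<Sum>b\<in>G. ip (r b) v *\<^sub>R b)) v"
      using real_vector.sum_representation_eq[OF G(2) _ G(1) order_refl] v G(3) r(2) by simp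
    also have "\<dots> = (\<Sum>b\<in>G. ip (r b) v * ip (T b) v)"
      by (simp add: linear_sum[OF T(1)] linear_scale[OF T(1)] linear_sum[OF linear_ip(2)] ip_simps)
    also have "\<dots> \<le> (\<Sum>b\<in>G. (\<alpha> (r b) + \<alpha> (T b)) / 2 * Q v)"
    proof (rule sum_mono)
      fix b assume "b \<in> G"
      then have "T b \<in> S" using G T by blast
      have "2 * (ip (r b) v * ip (T b) v) \<le> (ip (r b) v)\<^sup>2 + (ip (T b) v)\<^sup>2"
        using sum_squares_bound[of "ip (r b) v" "ip (T b) v"] by simp
      also have "\<dots> \<le> \<alpha> (r b) * Q v + \<alpha> (T b) * Q v"
        using \<alpha> r(1) v \<open>T b \<in> S\<close> by (intro add_mono) auto
      finally show "ip (r b) v * ip (T b) v \<le> (\<alpha> (r b) + \<alpha> (T b)) / 2 * Q v"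
        by (simp add: field_simps)
    qed
    finally show ?thesis by (simp add: sum_distrib_right)
  qed
  then show ?thesis by blast
qed

text \<open>The part of \<open>x\<close> orthogonal to the image of \<open>T\<close> lies in the kernel of \<open>T\<close>.\<close>

lemma self_adjoint_injective_imp_surjective:
  assumes S: "subspace S" and T: "linear T" "\<And>v. v \<in> S \<Longrightarrow> T v \<in> S"
    and sym: "\<And>v w. v \<in> S \<Longrightarrow> w \<in> S \<Longrightarrow> ip (T v) w = ip v (T w)"
    and inj: "\<And>v. v \<in> S \<Longrightarrow> T v = 0 \<Longrightarrow> v = 0"
  shows "T ` S = S"
proof
  show "T ` S \<subseteq> S" using T by blast
  show "S \<subseteq> T ` S"
  proof
    fix x assume x: "x \<in> S"
    obtain u where u: "u \<in> T ` S" "\<And>w. w \<in> T ` S \<Longrightarrow> ip (x - u) w = 0"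
      using orthogonal_projection_exists[OF linear_subspace_image[OF T(1) S]] by blast
    have r: "x - u \<in> S" using x u(1) T(2) by (auto intro: subspace_diff[OF S])
    then have "ip (T (x - u)) (T (x - u)) = 0"
      using sym[OF r T(2)[OF r]] u(2) T(2) by simp
    then have "x - u = 0" using inj[OF r] by (simp only: ip_eq_0_iff)
    then show "x \<in> T ` S" using u(1) by simp
  qed
qed

text \<open>The eigenvalue is the infimum \<open>c\<close> of the Rayleigh quotient. The operator \<open>B = T - c\<close> is positive
  semidefinite. If it had trivial kernel it would be surjective, so every functional on \<open>S\<close> would
  have the form \<open>ip (B t)\<close> and would be controlled by the form of \<open>B\<close> through the Cauchy-Schwarz
  inequality. Then \<open>|v|\<^sup>2 \<le> K ip (B v) v\<close>, so that \<open>c + 1/K\<close> is still a lower bound of the Rayleigh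
  quotient.\<close>

lemma self_adjoint_minimal_eigenvector:
  assumes S: "subspace S" and T: "linear T" "\<And>v. v \<in> S \<Longrightarrow> T v \<in> S"
    and sym: "\<And>v w. v \<in> S \<Longrightarrow> w \<in> S \<Longrightarrow> ip (T v) w = ip v (T w)"
    and nz: "s \<in> S" "s \<noteq> 0"
  obtains c v where "v \<in> S" "v \<noteq> 0" "T v = c *\<^sub>R v" "\<And>w. w \<in> S \<Longrightarrow> c * ip w w \<le> ip (T w) w"
proof -
  define R where "R = {ip (T w) w / ip w w | w. w \<in> S \<and> w \<noteq> 0}"
  define c where "c = Inf R"
  have "\<exists>K. \<forall>v\<in>S. ip (- T v) v \<le> K * ip v v"
    by (rule quadratic_form_bounded[OF S])
      (use T S Cauchy_Schwarz in \<open>auto simp: linear_compose_neg subspace_neg\<close>)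
  then obtain K where K: "- ip (T v) v \<le> K * ip v v" if "v \<in> S" for v by (auto simp: ip_simps)
  have "bdd_below R"
    unfolding R_def
  proof (rule bdd_belowI)
    fix x assume "x \<in> {ip (T w) w / ip w w | w. w \<in> S \<and> w \<noteq> 0}"
    then obtain w where w: "w \<in> S" "w \<noteq> 0" "x = ip (T w) w / ip w w" by blast
    have "ip (T w) w = x * ip w w" using w(3) ip_pos[OF w(2)] by simp
    then have "- x * ip w w \<le> K * ip w w" using K[OF w(1)] by simp
    then have "- x \<le> K" using ip_pos[OF w(2)] mult_le_cancel_right_pos by blast
    then show "- K \<le> x" by simp
  qed
  have R_ne: "R \<noteq> {}" using nz by (auto simp: R_def)
  have min: "c * ip w w \<le> ip (T w) w" if "w \<in> S" for w
  proof (cases "w = 0")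
    case False
    then have "c \<le> ip (T w) w / ip w w"
      unfolding c_def using that \<open>bdd_below R\<close> by (intro cInf_lower) (auto simp: R_def)
    then show ?thesis using ip_pos[OF False] by (simp add: field_simps)
  qed (simp add: ip_simps linear_0[OF T(1)])
  define B where "B v = T v - c *\<^sub>R v" for v
  have B: "linear B"
    unfolding B_def by (intro linear_compose_sub T linear_compose_scale_right linear_id[unfolded id_def])
  have BS: "B v \<in> S" if "v \<in> S" for v
    using that T S by (simp add: B_def subspace_diff subspace_scale)
  have Bsym: "ip (B v) w = ip v (B w)" if "v \<in> S" "w \<in> S" for v w
    using sym that by (simp add: B_def ip_simps)
  have Bpos: "ip (B v) v \<ge> 0" if "v \<in> S" for v
    using min that by (simp add: B_def ip_simps)
  have "\<exists>v\<in>S. v \<noteq> 0 \<and> B v = 0"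
  proof (rule ccontr)
    assume "\<not> ?thesis"
    then have surj: "B ` S = S"
      by (intro self_adjoint_injective_imp_surjective S B BS Bsym) auto
    have "\<exists>K. \<forall>v\<in>S. ip v v \<le> K * ip (B v) v"
    proof (rule quadratic_form_bounded[OF S])
      fix u assume "u \<in> S"
      then obtain t where "t \<in> S" "u = B t" using surj by blast
      then show "\<exists>\<alpha>. \<forall>v\<in>S. (ip u v)\<^sup>2 \<le> \<alpha> * ip (B v) v"
        using semidefinite_Cauchy_Schwarz[OF S B Bsym Bpos] by blast
    qed (auto simp: linear_iff)
    then obtain K where K: "ip v v \<le> K * ip (B v) v" if "v \<in> S" for v by blast
    have "K > 0"
      using K[OF nz(1)] ip_pos[OF nz(2)] Bpos[OF nz(1)]
      by (metis less_le_trans linorder_not_less mult_nonpos_nonneg)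
    have "c + 1 / K \<le> x" if x: "x \<in> R" for x
    proof -
      obtain w where w: "w \<in> S" "w \<noteq> 0" "x = ip (T w) w / ip w w" using x unfolding R_def by blast
      have "ip w w \<le> K * (ip (T w) w - c * ip w w)" using K[OF w(1)] by (simp add: B_def ip_simps)
      moreover have "ip (T w) w = x * ip w w" using w(3) ip_pos[OF w(2)] by simp
      ultimately have "1 * ip w w \<le> (K * (x - c)) * ip w w" by (simp add: algebra_simps)
      then have "1 \<le> K * (x - c)" using ip_pos[OF w(2)] mult_le_cancel_right_pos by blast
      then show ?thesis using \<open>K > 0\<close> by (simp add: field_simps)
    qed
    then have "c + 1 / K \<le> c" unfolding c_def using R_ne by (intro cInf_greatest) auto
    then show False using \<open>K > 0\<close> by simp
  qed
  then show ?thesis using that min by (auto simp: B_def)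
qed

end

section \<open>Jordan algebras with identity and associative inner product\<close>

locale euclidean_jordan_algebra = jordan_algebra mul + finite_dim_inner_product ip
  for mul :: "'a::real_vector \<Rightarrow> 'a \<Rightarrow> 'a" and ip :: "'a \<Rightarrow> 'a \<Rightarrow> real" +
  fixes E :: 'a
  assumes mul_one: "mul E X = X"
    and ip_mul_assoc: "ip (mul X Y) Z = ip X (mul Y Z)"
begin

lemmas mul_simps = bilinear_ladd[OF bilinear_mul] bilinear_radd[OF bilinear_mul]
  bilinear_lsub[OF bilinear_mul] bilinear_rsub[OF bilinear_mul]
  bilinear_lmul[OF bilinear_mul] bilinear_rmul[OF bilinear_mul]
  bilinear_lzero[OF bilinear_mul] bilinear_rzero[OF bilinear_mul]
  bilinear_lneg[OF bilinear_mul] bilinear_rneg[OF bilinear_mul]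

lemma linear_mul: "linear (mul X)"
  using bilinear_mul by (simp add: bilinear_def)

lemma mul_self_adjoint: "ip (mul X Y) Z = ip Y (mul X Z)"
  using ip_mul_assoc[of Y X Z] mul_commute[of X Y] by simp

lemma mul_one_right: "mul X E = X"
  using mul_one mul_commute by metis

text \<open>The part of the Jordan identity that is linear in \<open>Z\<close>, when \<open>X + Z\<close> is substituted for \<open>X\<close>.\<close>

lemma linearized_jordan_identity:
  "2 *\<^sub>R mul X (mul (mul X Z) Y) + mul Z (mul (mul X X) Y)
    = 2 *\<^sub>R mul (mul X Z) (mul X Y) + mul (mul X X) (mul Z Y)"
proof -
  define J where "J W = mul W (mul (mul W W) Y) - mul (mul W W) (mul W Y)" for W
  have "J W = 0" for W by (simp add: J_def jordan_identity)
  \<comment> \<open>The difference J (X + Z) - J (X - Z) leaves the parts of odd degree in Z; the cubic one is J Z.\<close>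
  then have "0 = J (X + Z) - J (X - Z) - 2 *\<^sub>R J Z" by simp
  also have "\<dots> = 2 *\<^sub>R ((2 *\<^sub>R mul X (mul (mul X Z) Y) + mul Z (mul (mul X X) Y))
    - (2 *\<^sub>R mul (mul X Z) (mul X Y) + mul (mul X X) (mul Z Y)))"
    unfolding J_def mul_commute[of Z X]
    by (simp add: mul_simps mul_commute[of Z X] algebra_simps scaleR_2)
  finally show ?thesis by simp
qed

definition jpower :: "'a \<Rightarrow> nat \<Rightarrow> 'a" where
  "jpower X n = (mul X ^^ n) E"

lemma jpower_0: "jpower X 0 = E"
  and jpower_Suc: "jpower X (Suc n) = mul X (jpower X n)"
  by (simp_all add: jpower_def)

text \<open>A fragment of power associativity: the Jordan identity moves \<open>X\<^sup>2\<close> past each factor \<open>X\<close>.\<close>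

lemma square_mul_jpower: "mul (mul X X) (jpower X n) = mul X (mul X (jpower X n))"
  by (induction n) (simp_all add: jpower_0 jpower_Suc mul_one_right flip: jordan_identity)

text \<open>Apply the linearized Jordan identity to the three elements \<open>X\<close>, \<open>Y\<close>, \<open>X\<^sup>n\<close>, with \<open>Y\<close>
  in the place of the variable \<open>Z\<close>. Then \<open>X Y = 0\<close> removes both terms with coefficient \<open>2\<close>.\<close>

lemma jpower_mul_annihilated:
  assumes "mul X Y = 0"
  shows "mul (jpower X (Suc (Suc n))) Y = mul (mul X X) (mul (jpower X n) Y)"
  using linearized_jordan_identity[of X Y "jpower X n"] assms
  by (simp add: mul_simps jpower_Suc square_mul_jpower mul_commute[of Y])

text \<open>The operators \<open>L w\<close> with \<open>w\<close> in the span \<open>\<real>[X]\<close> of the powers of \<open>X\<close> act on \<open>Y\<close> by scalars, as if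
  \<open>X\<close> were the number \<open>i \<surd>k\<close> and only real parts were kept. But \<open>X\<^sup>2 + k\<close> acts
  on \<open>\<real>[X]\<close> as \<open>(L X)\<^sup>2 + k\<close>, which is positive definite, so the identity is a multiple of
  \<open>X\<^sup>2 + k\<close>, whereas all such multiples annihilate \<open>Y\<close>.\<close>

lemma no_negative_square_eigenvalue:
  assumes XY: "mul X Y = 0" and neg: "mul (mul X X) Y = - (k *\<^sub>R Y)" and "k > 0"
  shows "Y = 0"
proof -
  define S where "S = span (range (jpower X))"
  define F where "F w = mul (mul X X) w + k *\<^sub>R w" for w
  have F: "linear F"
    unfolding F_def
    by (intro linear_compose_add linear_mul linear_compose_scale_right linear_id[unfolded id_def])
  have sq: "mul (mul X X) w = mul X (mul X w)" if "w \<in> S" for w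
    using that unfolding S_def
    by (induction rule: span_induct) (auto simp: subspace_def mul_simps square_mul_jpower)
  have S_X: "mul X w \<in> S" if "w \<in> S" for w
    using that unfolding S_def
  proof (induction rule: span_induct)
    case (step w)
    then obtain n where "w = jpower X n" by blast
    then show ?case using jpower_Suc[of X n] by (simp add: span_base flip: jpower_Suc)
  qed (auto simp: subspace_def mul_simps span_zero span_add span_scale)
  have S: "subspace S" by (simp add: S_def subspace_span)
  have S_F: "F w \<in> S" if "w \<in> S" for w
    using that S by (simp add: F_def sq S_X subspace_add subspace_scale)
  have "w = 0" if "w \<in> S" "F w = 0" for w
  proof -
    have "0 = ip (F w) w" by (simp add: that(2) ip_simps)
    also have "\<dots> = ip (mul X w) (mul X w) + k * ip w w"
      by (simp add: F_def ip_simps sq[OF that(1)] mul_self_adjoint[of X "mul X w"])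
    finally have "k * ip w w \<le> 0" using ip_nonneg[of "mul X w"] by simp
    then show ?thesis
      using \<open>k > 0\<close> ip_nonneg[of w] ip_eq_0_iff by (metis antisym mult_le_0_iff not_le)
  qed
  moreover have "ip (F v) w = ip v (F w)" for v w
    using mul_self_adjoint[of "mul X X" v w] by (simp add: F_def ip_simps)
  ultimately have "F ` S = S"
    using self_adjoint_injective_imp_surjective[OF S F S_F] by blast
  moreover have "E \<in> S" unfolding S_def using jpower_0 by (metis rangeI span_base)
  ultimately obtain w where w: "w \<in> S" "E = F w" by blast
  have line: "\<exists>a. mul (jpower X n) Y = a *\<^sub>R Y" for n
  proof (induction n rule: induct_nat_012)
    case 0
    then show ?case using mul_one[of Y] by (metis jpower_0 scaleR_one)
  next
    case 1
    then show ?case using XY by (metis jpower_0 jpower_Suc mul_one_right scaleR_zero_left)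
  next
    case (ge2 n)
    then obtain a where "mul (jpower X n) Y = a *\<^sub>R Y" by blast
    then have "mul (jpower X (Suc (Suc n))) Y = (- (a * k)) *\<^sub>R Y"
      by (simp add: jpower_mul_annihilated[OF XY] mul_simps neg)
    then show ?case by blast
  qed
  have "mul (F w) Y = 0" if "w \<in> S" for w
    using that unfolding S_def
  proof (induction rule: span_induct)
    case (step w)
    then obtain n where n: "w = jpower X n" by blast
    obtain a where a: "mul (jpower X n) Y = a *\<^sub>R Y" using line by blast
    have "mul (F w) Y = mul (jpower X (Suc (Suc n))) Y + k *\<^sub>R mul (jpower X n) Y"
      by (simp add: F_def n mul_simps square_mul_jpower jpower_Suc)
    also have "\<dots> = 0" by (simp add: jpower_mul_annihilated[OF XY] a mul_simps neg)
    finally show ?case by simp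
  qed (auto simp: subspace_def mul_simps linear_0[OF F] linear_add[OF F] linear_scale[OF F])
  then show ?thesis using w mul_one[of Y] by simp
qed

definition square_defect :: "'a \<Rightarrow> 'a \<Rightarrow> 'a" where
  "square_defect X Y = mul (mul X X) Y - mul X (mul X Y)"

lemma linear_square_defect: "linear (square_defect X)"
  by (rule linearI) (simp_all add: square_defect_def mul_simps algebra_simps)

lemma square_defect_self_adjoint: "ip (square_defect X Y) Z = ip Y (square_defect X Z)"
  using mul_self_adjoint[of "mul X X" Y Z] mul_self_adjoint[of X "mul X Y" Z]
    mul_self_adjoint[of X Y "mul X Z"]
  by (simp add: square_defect_def ip_simps)

lemma ip_square_defect: "ip (square_defect X Y) Y = ip (mul X X) (mul Y Y) - ip (mul X Y) (mul X Y)"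
  using ip_mul_assoc[of "mul X X" Y Y] mul_self_adjoint[of X "mul X Y" Y]
  by (simp add: square_defect_def ip_simps)

text \<open>A negative value of the form gives a negative eigenvalue \<open>c\<close> of \<open>square_defect X\<close>. Its eigenspace is
  invariant under \<open>mul X\<close>, and an eigenvector of \<open>mul X\<close> in it, with eigenvalue \<open>m\<close>, is annihilated
  by \<open>X - m E\<close> and has eigenvalue \<open>c\<close> under the square of \<open>X - m E\<close>, which
  \<open>no_negative_square_eigenvalue\<close> excludes.\<close>

lemma square_defect_nonneg: "ip (square_defect X Y) Y \<ge> 0"
proof (rule ccontr)
  let ?D = "square_defect X"
  assume neg: "\<not> ip (?D Y) Y \<ge> 0"
  then have "Y \<noteq> 0" by (auto simp: ip_simps)
  then obtain c v where v: "v \<noteq> 0" "?D v = c *\<^sub>R v" and min: "\<And>w. c * ip w w \<le> ip (?D w) w"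
    by (rule self_adjoint_minimal_eigenvector[OF subspace_UNIV linear_square_defect UNIV_I
        square_defect_self_adjoint UNIV_I]) blast
  have "c < 0" using min[of Y] neg ip_nonneg[of Y] by (smt (verit) mult_nonneg_nonneg)
  define V where "V = {w. ?D w = c *\<^sub>R w}"
  have V: "subspace V"
    unfolding V_def subspace_def
    using linear_0[OF linear_square_defect] linear_add[OF linear_square_defect]
      linear_scale[OF linear_square_defect]
    by (auto simp: scaleR_add_right)
  have V_X: "mul X w \<in> V" if "w \<in> V" for w
  proof -
    have "?D (mul X w) = mul X (?D w)"
      by (simp add: square_defect_def mul_simps jordan_identity)
    then show ?thesis using that by (simp add: V_def mul_simps)
  qed
  have "v \<in> V" using v by (simp add: V_def)
  obtain m y where y: "y \<in> V" "y \<noteq> 0" "mul X y = m *\<^sub>R y"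
    by (rule self_adjoint_minimal_eigenvector[OF V linear_mul V_X mul_self_adjoint \<open>v \<in> V\<close> v(1)])
  let ?X = "X - m *\<^sub>R E"
  have "mul (mul X X) y = (c + m * m) *\<^sub>R y"
    using y by (simp add: V_def square_defect_def mul_simps algebra_simps)
  then have "mul (mul ?X ?X) y = - ((- c) *\<^sub>R y)" "mul ?X y = 0"
    using y(3) by (simp_all add: mul_simps mul_one mul_one_right algebra_simps)
  then have "y = 0" using \<open>c < 0\<close> by (intro no_negative_square_eigenvalue[of ?X y "- c"]) auto
  then show False using y by simp
qed

section \<open>Curvature in terms of the product\<close>

lemma jordan_levi_civita_eq: "jordan_levi_civita mul ip X Y = (1/2) *\<^sub>R mul X Y"
proof -
  obtain B :: "'a set" where B: "finite B" "span B = UNIV" using finite_span by blast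
  have "is_jordan_levi_civita mul ip (\<lambda>X Y. (1/2) *\<^sub>R mul X Y)"
    unfolding is_jordan_levi_civita_def bilinear_def
    using mul_commute mul_self_adjoint
    by (auto intro!: linearI simp: mul_simps scaleR_add_right ip_simps simp flip: scaleR_add_left)
  moreover have "\<exists>!N. is_jordan_levi_civita mul ip N"
    by (rule jordan_levi_civita_ex1[OF jordan_algebra_axioms inner_product_ip B])
  ultimately have "jordan_levi_civita mul ip = (\<lambda>X Y. (1/2) *\<^sub>R mul X Y)"
    unfolding jordan_levi_civita_def by (simp add: the1_equality)
  then show ?thesis by simp
qed

text \<open>Self-adjointness of multiplication turns the three terms of the tensor into \<open>- |X Y|\<^sup>2 / 4\<close>,
  \<open>- \<langle>X\<^sup>2, Y\<^sup>2\<rangle> / 4\<close> and \<open>|X Y|\<^sup>2 / 2\<close>.\<close>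

lemma ip_jordan_curvature_tensor:
  "ip (jordan_curvature_tensor mul ip X Y X) Y = - ip (square_defect X Y) Y / 4"
proof -
  have "ip (mul Y (mul X X)) Y = ip (mul X X) (mul Y Y)"
    using mul_self_adjoint[of Y "mul X X" Y] .
  moreover have "ip (mul X (mul X Y)) Y = ip (mul X Y) (mul X Y)"
    using mul_self_adjoint[of X "mul X Y" Y] .
  ultimately show ?thesis
    unfolding jordan_curvature_tensor_def Let_def jordan_levi_civita_eq ip_square_defect
    by (simp add: mul_simps ip_simps mul_commute[of Y X] mul_commute[of "mul X Y" X])
qed

lemma lin_indep_pair_Gram_pos:
  assumes "lin_indep_pair X Y"
  shows "ip X X * ip Y Y - (ip X Y)\<^sup>2 > 0"
proof -
  have ind: "X \<noteq> Y" "independent {X, Y}" using assms by (auto simp: lin_indep_pair_def)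
  then have "Y \<noteq> 0" by (metis insertI1 insert_commute real_vector.dependent_zero)
  have "X \<notin> span {Y}" using ind by (simp add: real_vector.independent_insert)
  define k where "k = ip X Y / ip Y Y"
  have "X - k *\<^sub>R Y \<noteq> 0" using \<open>X \<notin> span {Y}\<close> by (metis eq_iff_diff_eq_0 span_base span_scale insertI1)
  then have "0 < ip (X - k *\<^sub>R Y) (X - k *\<^sub>R Y) * ip Y Y"
    using ip_pos \<open>Y \<noteq> 0\<close> by (intro mult_pos_pos)
  also have "\<dots> = ip X X * ip Y Y - (ip X Y)\<^sup>2"
    using ip_pos[OF \<open>Y \<noteq> 0\<close>] ip_commute[of Y X]
    by (simp add: ip_simps k_def field_simps power2_eq_square)
  finally show ?thesis .
qed

lemma jordan_curvature_eq:
  "jordan_curvature mul ip X Y =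
    - ip (square_defect X Y) Y / (4 * (ip X X * ip Y Y - (ip X Y)\<^sup>2))"
  by (simp add: jordan_curvature_def ip_jordan_curvature_tensor)

lemma jordan_curvature_nonpos:
  assumes "lin_indep_pair X Y"
  shows "jordan_curvature mul ip X Y \<le> 0"
  unfolding jordan_curvature_eq
  using square_defect_nonneg[of X Y] lin_indep_pair_Gram_pos[OF assms]
  by (intro divide_nonpos_pos) auto

text \<open>A positive semidefinite self-adjoint operator with vanishing quadratic form is zero. For linearly
  dependent pairs, where the curvature says nothing, the form vanishes by commutativity.\<close>

lemma flat_imp_square_defect_eq_0:
  assumes flat: "\<And>X Y. lin_indep_pair X Y \<Longrightarrow> jordan_curvature mul ip X Y = 0"
  shows "square_defect X Y = 0"
proof -
  have q: "ip (square_defect X Z) Z = 0" for Z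
  proof (cases "lin_indep_pair X Z")
    case True
    then show ?thesis
      using flat[OF True] lin_indep_pair_Gram_pos[OF True] by (simp add: jordan_curvature_eq)
  next
    case False
    have "Z = 1 *\<^sub>R X" if "X = Z" using that by simp
    moreover have "\<exists>k. Z = k *\<^sub>R X" if "X \<noteq> 0" "X \<noteq> Z" "dependent {X, Z}"
    proof -
      have "independent {X}" using that(1) by simp
      then have "Z \<in> span {X}"
        using real_vector.independent_insert[of Z "{X}"] that(2,3) by (auto simp: insert_commute)
      then show ?thesis by (auto simp: span_singleton)
    qed
    moreover have "\<exists>k. Z = k *\<^sub>R X" if "Z = 0" using that by (metis scaleR_zero_left)
    ultimately consider "X = 0" | k where "Z = k *\<^sub>R X"
      using False unfolding lin_indep_pair_def by blast
    then show ?thesis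
      by cases (simp_all add: square_defect_def mul_simps ip_simps mul_commute)
  qed
  have "(ip (square_defect X Y) Z)\<^sup>2 \<le> ip (square_defect X Y) Y * ip (square_defect X Z) Z" for Z
    by (rule semidefinite_Cauchy_Schwarz[of UNIV])
      (use linear_square_defect square_defect_self_adjoint square_defect_nonneg in \<open>simp_all only: subspace_UNIV UNIV_I\<close>)
  then have "ip (square_defect X Y) Z = 0" for Z by (simp add: q)
  then show ?thesis using ip_eq_0_iff by blast
qed

section \<open>Flat algebras\<close>

text \<open>Polarizing \<open>X\<^sup>2 Z = X (X Z)\<close> gives \<open>2 (X Y) Z = X (Y Z) + Y (X Z)\<close>. By commutativity the three
  products of \<open>X\<close>, \<open>Y\<close>, \<open>Z\<close> are permuted cyclically by renaming, so each of them is the mean of the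
  other two and all three agree.\<close>

lemma square_defect_0_imp_associative:
  assumes "\<And>X Y. square_defect X Y = 0"
  shows "mul (mul X Y) Z = mul X (mul Y Z)"
proof -
  have lin: "2 *\<^sub>R mul (mul X Y) Z = mul X (mul Y Z) + mul Y (mul X Z)" for X Y Z
  proof -
    have "square_defect (X + Y) Z - square_defect X Z - square_defect Y Z = 0"
      by (simp add: assms)
    then show ?thesis
      by (simp add: square_defect_def mul_simps mul_commute[of Y X] algebra_simps scaleR_2)
  qed
  let ?a = "mul (mul X Y) Z" and ?b = "mul X (mul Y Z)" and ?c = "mul Y (mul X Z)"
  have "2 *\<^sub>R ?a = ?b + ?c" by (rule lin)
  moreover have "2 *\<^sub>R ?b = ?c + ?a"
    using lin[of Y Z X] by (metis mul_commute)
  ultimately have "?a + 2 *\<^sub>R ?a = ?b + 2 *\<^sub>R ?b" by (simp add: add_ac)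
  then have "3 *\<^sub>R ?a = 3 *\<^sub>R ?b" 
    using scaleR_left_distrib[of 1 2 ?a] scaleR_left_distrib[of 1 2 ?b] by simp
  then show ?thesis by simp
qed

text \<open>The last condition makes the line through \<open>e\<close> an ideal.\<close>

definition ideal_idempotents :: "'a set" where
  "ideal_idempotents = {e. e \<noteq> 0 \<and> mul e e = e \<and> (\<forall>Y. \<exists>c. mul Y e = c *\<^sub>R e)}"

text \<open>The product lies on both lines. If it were nonzero, the lines would coincide, and the only nonzero
  idempotent on such a line is its generator.\<close>

lemma ideal_idempotents_mul:
  assumes e: "e \<in> ideal_idempotents" and f: "f \<in> ideal_idempotents" and "e \<noteq> f"
  shows "mul e f = 0"
proof -
  obtain a where a: "mul e f = a *\<^sub>R f" using f by (auto simp: ideal_idempotents_def)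
  obtain b where b: "mul f e = b *\<^sub>R e" using e by (auto simp: ideal_idempotents_def)
  have idem: "mul e e = e" "mul f f = f" using e f by (auto simp: ideal_idempotents_def)
  have ab: "a *\<^sub>R f = b *\<^sub>R e" using a b mul_commute[of e f] by simp
  show ?thesis
  proof (rule ccontr)
    assume nz: "mul e f \<noteq> 0"
    have "a *\<^sub>R (a *\<^sub>R f) = mul e (a *\<^sub>R f)" by (simp only: mul_simps a)
    also have "\<dots> = a *\<^sub>R f" by (simp only: ab mul_simps idem)
    finally have "a = 1" using nz by (auto simp: a)
    have "b *\<^sub>R (b *\<^sub>R e) = mul f (b *\<^sub>R e)" by (simp only: mul_simps b)
    also have "\<dots> = b *\<^sub>R e" by (simp only: mul_simps idem flip: ab)
    finally have "b = 1" using nz by (auto simp: a ab)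
    show False using ab \<open>a = 1\<close> \<open>b = 1\<close> \<open>e \<noteq> f\<close> by simp
  qed
qed

lemma ideal_idempotents_orthogonal:
  assumes "e \<in> ideal_idempotents" "f \<in> ideal_idempotents" "e \<noteq> f"
  shows "ip e f = 0"
proof -
  have "ip e f = ip (mul e e) f" using assms by (simp add: ideal_idempotents_def)
  also have "\<dots> = ip e (mul e f)" by (rule ip_mul_assoc)
  finally show ?thesis using ideal_idempotents_mul[OF assms] by (simp add: ip_simps)
qed

lemma finite_ideal_idempotents: "finite ideal_idempotents"
proof -
  have "independent ideal_idempotents"
  proof
    assume "dependent ideal_idempotents"
    then obtain e where e: "e \<in> ideal_idempotents" "e \<in> span (ideal_idempotents - {e})"
      by (auto simp: real_vector.dependent_def)
    have "ip e x = 0" if "x \<in> span (ideal_idempotents - {e})" for x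
      using that
      by (induction rule: span_induct)
        (use e(1) ideal_idempotents_orthogonal in \<open>auto simp: subspace_def ip_simps\<close>)
    from this[OF e(2)] show False using e(1) by (auto simp: ip_eq_0_iff ideal_idempotents_def)
  qed
  moreover obtain B :: "'a set" where "finite B" "span B = UNIV" using finite_span by blast
  ultimately show ?thesis using real_vector.independent_span_bound[of B ideal_idempotents] by simp
qed

text \<open>In a commutative associative algebra all multiplications commute with each other, so an eigenspace
  of \<open>mul Y\<close> in an ideal is again an ideal. Treat the elements of \<open>F\<close> one after another.\<close>

lemma common_eigenideal:
  assumes assoc: "\<And>X Y Z. mul (mul X Y) Z = mul X (mul Y Z)"
    and J: "jordan_ideal mul J" "v \<in> J" "v \<noteq> 0" and "finite F"
  shows "\<exists>I. jordan_ideal mul I \<and> I \<subseteq> J \<and> (\<exists>v\<in>I. v \<noteq> 0) \<and>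
    (\<forall>Y\<in>F. \<exists>c. \<forall>w\<in>I. mul Y w = c *\<^sub>R w)"
  using \<open>finite F\<close>
proof (induction F rule: finite_induct)
  case empty
  then show ?case using J by auto
next
  case (insert Y F)
  then obtain I u where I: "jordan_ideal mul I" "I \<subseteq> J" "u \<in> I" "u \<noteq> 0"
    "\<forall>Y\<in>F. \<exists>c. \<forall>w\<in>I. mul Y w = c *\<^sub>R w" by blast
  have sub: "subspace I" and closed: "\<And>w. w \<in> I \<Longrightarrow> mul Y w \<in> I"
    using I(1) by (auto simp: jordan_ideal_def)
  obtain c x where x: "x \<in> I" "x \<noteq> 0" "mul Y x = c *\<^sub>R x"
    by (rule self_adjoint_minimal_eigenvector[OF sub linear_mul closed mul_self_adjoint I(3,4)])
  define K where "K = {w \<in> I. mul Y w = c *\<^sub>R w}"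
  have "mul Z w \<in> K" if "w \<in> K" for Z w
  proof -
    have "mul Y (mul Z w) = mul Z (mul Y w)"
      using assoc[of Y Z w] assoc[of Z Y w] mul_commute[of Y Z] by simp
    then show ?thesis using that I(1) by (auto simp: K_def jordan_ideal_def mul_simps)
  qed
  moreover have "subspace K"
    using sub by (auto simp: K_def subspace_def mul_simps scaleR_add_right)
  ultimately have "jordan_ideal mul K"
    unfolding jordan_ideal_def using mul_commute by metis
  moreover have "K \<subseteq> I" "x \<in> K" using x by (auto simp: K_def)
  moreover have "\<forall>Z\<in>insert Y F. \<exists>c. \<forall>w\<in>K. mul Z w = c *\<^sub>R w"
    using I(5) unfolding K_def by blast
  ultimately show ?case using I(2) x(2) by blast
qed

text \<open>With a spanning set for \<open>F\<close>, every multiplication is a scalar on the common eigenideal \<open>I\<close>, and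
  each \<open>u \<noteq> 0\<close> in \<open>I\<close> spans an ideal. Its square \<open>c u\<close> is nonzero because
  \<open>ip (mul u u) E = ip u u\<close>, so \<open>u / c\<close> is idempotent.\<close>

lemma ideal_contains_ideal_idempotent:
  assumes assoc: "\<And>X Y Z. mul (mul X Y) Z = mul X (mul Y Z)"
    and J: "jordan_ideal mul J" "v \<in> J" "v \<noteq> 0"
  shows "\<exists>e\<in>ideal_idempotents. e \<in> J"
proof -
  obtain B :: "'a set" where B: "finite B" "span B = UNIV" using finite_span by blast
  obtain I u where I: "jordan_ideal mul I" "I \<subseteq> J" "u \<in> I" "u \<noteq> 0"
    "\<forall>Y\<in>B. \<exists>c. \<forall>w\<in>I. mul Y w = c *\<^sub>R w"
    using common_eigenideal[OF assoc J B(1)] by blast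
  have scal: "\<exists>c. mul Y u = c *\<^sub>R u" for Y
  proof -
    have "subspace {Y. \<exists>c. mul Y u = c *\<^sub>R u}"
    proof (unfold subspace_def, intro conjI ballI allI; clarify)
      show "\<exists>c. mul 0 u = c *\<^sub>R u" by (rule exI[of _ 0]) (simp add: mul_simps)
    next
      fix Y Z b c assume "mul Y u = b *\<^sub>R u" "mul Z u = c *\<^sub>R u"
      then have "mul (Y + Z) u = (b + c) *\<^sub>R u" by (simp add: mul_simps scaleR_add_left)
      then show "\<exists>c. mul (Y + Z) u = c *\<^sub>R u" ..
    next
      fix a Y c assume "mul Y u = c *\<^sub>R u"
      then have "mul (a *\<^sub>R Y) u = (a * c) *\<^sub>R u" by (simp add: mul_simps)
      then show "\<exists>c. mul (a *\<^sub>R Y) u = c *\<^sub>R u" ..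
    qed
    moreover have "B \<subseteq> {Y. \<exists>c. mul Y u = c *\<^sub>R u}" using I(3,5) by blast
    ultimately have "span B \<subseteq> {Y. \<exists>c. mul Y u = c *\<^sub>R u}" by (rule span_minimal[rotated])
    then show ?thesis using B(2) by blast
  qed
  then obtain c where c: "mul u u = c *\<^sub>R u" by blast
  have "ip (mul u u) E = ip u u" by (simp add: ip_mul_assoc mul_one_right)
  then have "c \<noteq> 0" using c ip_pos[OF I(4)] by (auto simp: ip_simps)
  define e where "e = (1 / c) *\<^sub>R u"
  have "\<exists>k. mul Y e = k *\<^sub>R e" for Y
    using scal[of Y] by (auto simp: e_def mul_simps)
  then have "e \<in> ideal_idempotents"
    using \<open>c \<noteq> 0\<close> I(4) c by (auto simp: ideal_idempotents_def e_def mul_simps)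
  moreover have "e \<in> J"
    using I J by (auto simp: e_def jordan_ideal_def intro!: subspace_scale)
  ultimately show ?thesis by blast
qed

text \<open>By self-adjointness the orthogonal complement \<open>J\<close> of these idempotents is an ideal. It contains
  none of them, as none is orthogonal to itself; hence \<open>J = 0\<close>.\<close>

lemma span_ideal_idempotents:
  assumes assoc: "\<And>X Y Z. mul (mul X Y) Z = mul X (mul Y Z)"
  shows "span ideal_idempotents = UNIV"
proof -
  define J where "J = {x. \<forall>e\<in>ideal_idempotents. ip x e = 0}"
  have "mul Y x \<in> J" if x: "x \<in> J" for x Y
    unfolding J_def
  proof clarify
    fix e assume e: "e \<in> ideal_idempotents"
    then obtain c where "mul Y e = c *\<^sub>R e" by (auto simp: ideal_idempotents_def)
    then show "ip (mul Y x) e = 0"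
      using x e mul_self_adjoint[of Y x e] by (simp add: J_def ip_simps)
  qed
  moreover have "subspace J" by (auto simp: J_def subspace_def ip_simps)
  ultimately have J: "jordan_ideal mul J"
    unfolding jordan_ideal_def using mul_commute by metis
  have J0: "x = 0" if "x \<in> J" for x
  proof (rule ccontr)
    assume "x \<noteq> 0"
    then obtain e where "e \<in> ideal_idempotents" "e \<in> J"
      using ideal_contains_ideal_idempotent[OF assoc J \<open>x \<in> J\<close>] by blast
    then show False by (auto simp: J_def ip_eq_0_iff ideal_idempotents_def)
  qed
  have "X \<in> span ideal_idempotents" for X
  proof -
    obtain u where u: "u \<in> span ideal_idempotents"
      "\<And>w. w \<in> span ideal_idempotents \<Longrightarrow> ip (X - u) w = 0"
      using orthogonal_projection_exists[OF subspace_span] by blast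
    then have "X - u \<in> J" by (simp add: J_def span_base)
    then show ?thesis using J0 u(1) by fastforce
  qed
  then show ?thesis by blast
qed

lemma associative_imp_direct_sum:
  assumes assoc: "\<And>X Y Z. mul (mul X Y) Z = mul X (mul Y Z)"
  shows "direct_sum_of_one_dim_simple mul"
proof -
  let ?C = ideal_idempotents
  define n where "n = card ?C"
  obtain e where e: "bij_betw e {..<n} ?C"
    using ex_bij_betw_nat_finite[OF finite_ideal_idempotents] by (auto simp: n_def atLeast0LessThan)
  have eC: "e i \<in> ?C" if "i < n" for i using e that by (auto simp: bij_betw_def)
  have pos: "ip (e i) (e i) > 0" if "i < n" for i
    using eC[OF that] ip_pos by (auto simp: ideal_idempotents_def)
  have orth: "ip (e i) (e j) = 0" if "i < n" "j < n" "i \<noteq> j" for i j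
  proof -
    have "e i \<noteq> e j" using e that by (auto simp: bij_betw_def inj_on_def)
    then show ?thesis using ideal_idempotents_orthogonal eC that by blast
  qed
  have coord: "ip (\<Sum>i<n. a i *\<^sub>R e i) (e j) = a j * ip (e j) (e j)" if "j < n" for a j
  proof -
    have "ip (\<Sum>i<n. a i *\<^sub>R e i) (e j) = (\<Sum>i<n. a i * ip (e i) (e j))"
      by (simp add: linear_sum[OF linear_ip(2)] ip_simps)
    also have "\<dots> = (\<Sum>i<n. if i = j then a j * ip (e j) (e j) else 0)"
      using orth that by (intro sum.cong) auto
    finally show ?thesis using that by simp
  qed
  have ideal: "jordan_ideal mul (span {e i})" if i: "i < n" for i
  proof -
    have "mul Y x \<in> span {e i}" if x: "x \<in> span {e i}" for x Y
    proof -
      obtain c where "mul Y (e i) = c *\<^sub>R e i" using eC[OF i] by (auto simp: ideal_idempotents_def)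
      then show ?thesis using x by (auto simp: span_singleton mul_simps)
    qed
    then show ?thesis
      unfolding jordan_ideal_def using mul_commute subspace_span by metis
  qed
  have "\<exists>!f. f \<in> (\<Pi>\<^sub>E i\<in>{..<n}. span {e i}) \<and> X = (\<Sum>i<n. f i)" for X
  proof -
    have "X \<in> span ?C" using span_ideal_idempotents[OF assoc] by simp
    then obtain u where "X = (\<Sum>x\<in>?C. u x *\<^sub>R x)"
      using span_finite[OF finite_ideal_idempotents] by auto
    also have "\<dots> = (\<Sum>i<n. u (e i) *\<^sub>R e i)"
      by (rule sum.reindex_bij_betw[OF e, symmetric])
    finally have X: "X = (\<Sum>i<n. u (e i) *\<^sub>R e i)" .
    show ?thesis
    proof (rule ex1I[of _ "\<lambda>i\<in>{..<n}. u (e i) *\<^sub>R e i"])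
      show "(\<lambda>i\<in>{..<n}. u (e i) *\<^sub>R e i) \<in> (\<Pi>\<^sub>E i\<in>{..<n}. span {e i}) \<and>
        X = (\<Sum>i<n. (\<lambda>i\<in>{..<n}. u (e i) *\<^sub>R e i) i)"
        using X by (auto simp: span_singleton)
    next
      fix f assume f: "f \<in> (\<Pi>\<^sub>E i\<in>{..<n}. span {e i}) \<and> X = (\<Sum>i<n. f i)"
      then have "\<forall>i\<in>{..<n}. \<exists>c. f i = c *\<^sub>R e i"
        by (auto simp: span_singleton PiE_iff)
      then have "\<exists>a. \<forall>i\<in>{..<n}. f i = a i *\<^sub>R e i" by (rule bchoice)
      then obtain a where a: "\<And>i. i < n \<Longrightarrow> f i = a i *\<^sub>R e i" by auto
      have "X = (\<Sum>i<n. a i *\<^sub>R e i)" using f a by simp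
      then have "a j = u (e j)" if "j < n" for j
        using coord[OF that, of a] coord[OF that, of "\<lambda>i. u (e i)"] X pos[OF that] by simp
      then show "f = (\<lambda>i\<in>{..<n}. u (e i) *\<^sub>R e i)"
        using f a by (intro PiE_ext[of f "{..<n}" "\<lambda>i. span {e i}"]) (auto simp: span_singleton)
    qed
  qed
  then have "is_direct_sum mul n (\<lambda>i. span {e i})"
    using ideal by (simp add: is_direct_sum_def)
  moreover have "one_dim_simple mul (span {e i})" if "i < n" for i
    using eC[OF that] by (auto simp: one_dim_simple_def ideal_idempotents_def)
  ultimately show ?thesis unfolding direct_sum_of_one_dim_simple_def by blast
qed

text \<open>The element \<open>z\<close>, placed in position \<open>i\<close> or in position \<open>j\<close>, gives two decompositions of \<open>z\<close>.\<close>

lemma direct_sum_summands_disjoint: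
  assumes ds: "is_direct_sum mul n I" and ij: "i < n" "j < n" "i \<noteq> j" and z: "z \<in> I i" "z \<in> I j"
  shows "z = 0"
proof -
  define f where "f k = (\<lambda>l\<in>{..<n}. if l = k then z else 0)" for k
  have f: "f k \<in> (\<Pi>\<^sub>E i\<in>{..<n}. I i) \<and> z = (\<Sum>i<n. f k i)" if "k < n" "z \<in> I k" for k
    using that ds by (auto simp: f_def is_direct_sum_def jordan_ideal_def subspace_0)
  have "\<exists>!g. g \<in> (\<Pi>\<^sub>E i\<in>{..<n}. I i) \<and> z = (\<Sum>i<n. g i)"
    using ds by (simp only: is_direct_sum_def)
  then have "f i = f j" using f[OF ij(1) z(1)] f[OF ij(2) z(2)] by (elim ex1E) metis
  then have "f i i = f j i" by simp
  then show ?thesis using ij by (simp add: f_def)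
qed

text \<open>Products of distinct summands lie in their intersection, so the algebra multiplies coordinatewise.\<close>

lemma direct_sum_imp_square_defect_eq_0:
  assumes "direct_sum_of_one_dim_simple mul"
  shows "square_defect X Y = 0"
proof -
  obtain n I where ds: "is_direct_sum mul n I" and "\<forall>i<n. one_dim_simple mul (I i)"
    using assms by (auto simp: direct_sum_of_one_dim_simple_def)
  then have "\<forall>i\<in>{..<n}. \<exists>e. mul e e = e \<and> I i = span {e}" by (auto simp: one_dim_simple_def)
  then have "\<exists>e. \<forall>i\<in>{..<n}. mul (e i) (e i) = e i \<and> I i = span {e i}" by (rule bchoice)
  then obtain e where e: "\<And>i. i < n \<Longrightarrow> mul (e i) (e i) = e i" "\<And>i. i < n \<Longrightarrow> I i = span {e i}"
    by auto
  have orth: "mul (e i) (e j) = 0" if ij: "i < n" "j < n" "i \<noteq> j" for i j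
  proof (rule direct_sum_summands_disjoint[OF ds ij])
    have "e i \<in> I i" "e j \<in> I j" using e(2) ij by (auto simp: span_base)
    then show "mul (e i) (e j) \<in> I i" "mul (e i) (e j) \<in> I j"
      using ds ij by (auto simp: is_direct_sum_def jordan_ideal_def)
  qed
  have coords: "\<exists>a. Z = (\<Sum>i<n. a i *\<^sub>R e i)" for Z
  proof -
    obtain f where f: "f \<in> (\<Pi>\<^sub>E i\<in>{..<n}. I i)" "Z = (\<Sum>i<n. f i)"
      using ds unfolding is_direct_sum_def by blast
    then have "\<forall>i\<in>{..<n}. \<exists>c. f i = c *\<^sub>R e i"
      using e(2) by (auto simp: span_singleton PiE_iff)
    then have "\<exists>a. \<forall>i\<in>{..<n}. f i = a i *\<^sub>R e i" by (rule bchoice)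
    then show ?thesis using f(2) by auto
  qed
  have prod: "mul (\<Sum>i<n. a i *\<^sub>R e i) (\<Sum>i<n. b i *\<^sub>R e i) = (\<Sum>i<n. (a i * b i) *\<^sub>R e i)" for a b
  proof -
    have "mul (\<Sum>i<n. a i *\<^sub>R e i) (\<Sum>i<n. b i *\<^sub>R e i)
      = (\<Sum>i<n. \<Sum>j<n. (a i * b j) *\<^sub>R mul (e i) (e j))"
      unfolding bilinear_sum[OF bilinear_mul] sum.cartesian_product
      by (intro sum.cong refl) (auto simp: mul_simps)
    also have "\<dots> = (\<Sum>i<n. \<Sum>j<n. if j = i then (a i * b i) *\<^sub>R e i else 0)"
      using orth e(1) by (intro sum.cong) auto
    finally show ?thesis by simp
  qed
  obtain a where a: "X = (\<Sum>i<n. a i *\<^sub>R e i)" using coords by blast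
  obtain b where b: "Y = (\<Sum>i<n. b i *\<^sub>R e i)" using coords by blast
  show ?thesis unfolding square_defect_def a b prod by (simp add: mult.assoc)
qed

end

theorem theorem4p5:
  fixes mul :: "'a::real_vector \<Rightarrow> 'a \<Rightarrow> 'a" and ip :: "'a \<Rightarrow> 'a \<Rightarrow> real"
  assumes "finite_dim_formally_real_jordan_algebra mul"
    and "associative_inner_product mul ip"
  shows "(\<forall>X Y. lin_indep_pair X Y \<longrightarrow> jordan_curvature mul ip X Y \<le> 0) \<and>
    ((\<forall>X Y. lin_indep_pair X Y \<longrightarrow> jordan_curvature mul ip X Y = 0) \<longleftrightarrow>
      direct_sum_of_one_dim_simple mul)"
proof -
  interpret finite_dim_formally_real_jordan_algebra mul by fact
  obtain E where "\<And>X. mul E X = X" using identity_exists by blast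
  then interpret euclidean_jordan_algebra mul ip E
    using assms(2) finite_dim by unfold_locales (auto simp: associative_inner_product_def)
  have "direct_sum_of_one_dim_simple mul"
    if "\<forall>X Y. lin_indep_pair X Y \<longrightarrow> jordan_curvature mul ip X Y = 0"
    using that
    by (intro associative_imp_direct_sum square_defect_0_imp_associative
        flat_imp_square_defect_eq_0) blast
  moreover have "jordan_curvature mul ip X Y = 0" if "direct_sum_of_one_dim_simple mul" for X Y
    by (simp add: jordan_curvature_eq direct_sum_imp_square_defect_eq_0[OF that] ip_simps)
  ultimately show ?thesis using jordan_curvature_nonpos by blast
qed

end
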